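(* Let $T>0$, let $X=\{X_t\}_{t\in[0,T]}$ with $X_0=0$ and $a=\{a_t\}_{t\in[0,T]}$ be real-valued stochastic processes on a complete probability space $(\Omega,\mathcal F,\mathbb P)$ (not assumed independent, not assumed continuous) such that the Lebesgue integrals $\int_0^t a_s\,\mathrm ds$ are well defined, and set $y_t=X_t+\int_0^t a_s\,\mathrm ds$ for $t\in[0,T]$. Then for every $\epsilon>0$, $$\mathbb P(\|y\|_\infty\le\epsilon)\le \inf_{p>0}\ \inf_{(N,\delta,I)\in\mathcal A_p(\epsilon)}\Big\{\mathbb P\big(\big||\mathbf X|_p-I\big|\ge 2^{-2}I\big)+\mathbb P\big(\|a\|_\infty\ge 2^{-2}I N^{-1/p}\delta^{-1}\big)\Big\}.$$
   Context: $\|f\|_\infty=\sup_{t\in[0,T]}|f_t|$. For $p>0$, $N\in\mathbb N=\{1,2,\dots\}$ and $\delta>0$ with $N\delta\le T$, put $t_k=k\delta$ for $k=0,\dots,N$ and $$|\mathbf X|_p=\Big[\sum_{k=1}^N|X_{t_k}-X_{t_{k-1}}|^p\Big]^{1/p}$$ (this depends on $N$ and $\delta$). With $\mathbb R_+=(0,\infty)$, $$\mathcal A_p(\epsilon)=\big\{(N,\delta,I)\in\mathbb N\times\mathbb R_+\times\mathbb R_+ : 4N^{1/p}\le I\epsilon^{-1},\ N\delta\le T\big\}.$$ It is understood that $\|y\|_\infty$ and $\|a\|_\infty$ are ($[0,\infty]$-valued) random variables. *)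

theory Defs
  imports "HOL-Probability.Probability"
begin

(* The values lie in [0,\<infinity>]; paths need not be bounded. *)
definition path_sup_norm :: "real \<Rightarrow> (real \<Rightarrow> real) \<Rightarrow> ennreal" where
  "path_sup_norm T f = (SUP t\<in>{0..T}. ennreal \<bar>f t\<bar>)"

definition increment_lp :: "real \<Rightarrow> nat \<Rightarrow> real \<Rightarrow> (real \<Rightarrow> real) \<Rightarrow> real" where
  "increment_lp p N \<delta> x =
     (\<Sum>k=1..N. \<bar>x (real k * \<delta>) - x (real (k - 1) * \<delta>)\<bar> powr p) powr (1 / p)"

definition admissible :: "real \<Rightarrow> real \<Rightarrow> real \<Rightarrow> (nat \<times> real \<times> real) set" where
  "admissible T p \<epsilon> =
     {(N, \<delta>, I). 1 \<le> N \<and> 0 < \<delta> \<and> 0 < I \<and>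
        4 * real N powr (1 / p) \<le> I / \<epsilon> \<and> real N * \<delta> \<le> T}"

(* The infimum over an admissible set is taken in the reals, where Inf is only
   meaningful on nonempty sets that are bounded below. *)
lemma admissible_nonempty:
  assumes "0 < T" "0 < \<epsilon>"
  shows "admissible T p \<epsilon> \<noteq> {}"
proof -
  have "(1, T, 4 * \<epsilon>) \<in> admissible T p \<epsilon>"
    using assms by (simp add: admissible_def)
  then show ?thesis by blast
qed

end

theory Submission
  imports Defs
begin

text \<open>
  Put \<open>c = I N powr (-1/p) / 4\<close>. On the event that \<open>\<bar>y\<bar> \<le> \<epsilon>\<close> and \<open>\<bar>a\<bar> \<le> c / \<delta>\<close> on \<open>[0, T]\<close>,
  every increment of \<open>X\<close> is at most \<open>2 \<epsilon> + c\<close>, and admissibility gives \<open>2 \<epsilon> \<le> 2 c\<close>. Hence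
  \<open>|X|\<^sub>p \<le> N powr (1/p) * 3 c = 3 I / 4\<close>, which is at distance at least \<open>I / 4\<close> from \<open>I\<close>.
  Bounding the increments one by one, instead of applying Minkowski's inequality, also covers
  \<open>p < 1\<close>.
\<close>

lemma abs_le_of_path_sup_norm_le:
  assumes "path_sup_norm T f \<le> ennreal c" "0 \<le> c" "t \<in> {0..T}"
  shows "\<bar>f t\<bar> \<le> c"
proof -
  have "ennreal \<bar>f t\<bar> \<le> path_sup_norm T f"
    unfolding path_sup_norm_def using assms(3) by (rule SUP_upper)
  with assms(1) have "ennreal \<bar>f t\<bar> \<le> ennreal c"
    by (rule order_trans[rotated])
  with assms(2) show ?thesis by simp
qed

lemma increment_lp_le:
  assumes "0 < p" "0 \<le> c"
    and "\<And>k. k \<in> {1..N} \<Longrightarrow> \<bar>x (real k * \<delta>) - x (real (k - 1) * \<delta>)\<bar> \<le> c"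
  shows "increment_lp p N \<delta> x \<le> real N powr (1 / p) * c"
proof -
  let ?S = "\<Sum>k=1..N. \<bar>x (real k * \<delta>) - x (real (k - 1) * \<delta>)\<bar> powr p"
  have "?S \<le> (\<Sum>k=1..N. c powr p)"
    using assms by (intro sum_mono powr_mono2) auto
  then have "?S \<le> real N * c powr p" by simp
  then have "?S powr (1 / p) \<le> (real N * c powr p) powr (1 / p)"
    using assms(1) by (intro powr_mono2 sum_nonneg) auto
  \<comment> \<open>The exponents of \<open>c\<close> multiply to 1, and \<open>c powr 1 = c\<close>
    because \<open>0 \<le> c\<close>.\<close>
  also have "\<dots> = real N powr (1 / p) * c"
    using assms(1,2) by (simp add: powr_mult powr_powr)
  finally show ?thesis unfolding increment_lp_def .
qed

text \<open>Only the finitely many grid times \<open>real k * \<delta>\<close> with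
  \<open>k \<le> N\<close> enter, and all of them lie in [0, T]; measurability of each single
  \<open>X t\<close> therefore suffices, without regularity of the paths.\<close>

lemma increment_lp_measurable:
  assumes "0 \<le> \<delta>" "real N * \<delta> \<le> T"
    and "\<And>t. t \<in> {0..T} \<Longrightarrow> X t \<in> borel_measurable M"
  shows "(\<lambda>\<omega>. increment_lp p N \<delta> (\<lambda>t. X t \<omega>)) \<in> borel_measurable M"
proof -
  have "X (real k * \<delta>) \<in> borel_measurable M" if "k \<le> N" for k
  proof -
    have "real k * \<delta> \<le> real N * \<delta>" using that assms(1) by (simp add: mult_right_mono)
    then show ?thesis using assms by simp
  qed
  then have "(\<lambda>\<omega>. X (real k * \<delta>) \<omega>) \<in> borel_measurable M"
    "(\<lambda>\<omega>. X (real (k - 1) * \<delta>) \<omega>) \<in> borel_measurable M" if "k \<in> {1..N}" for k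
    \<comment> \<open>The term \<open>real (k - 1)\<close> is kept intact so that the previous fact
      applies with index \<open>k - 1\<close>.\<close>
    using that by (auto simp del: of_nat_diff)
  then show ?thesis
    unfolding increment_lp_def
    by (intro powr_real_measurable borel_measurable_sum borel_measurable_abs
        borel_measurable_diff borel_measurable_const)
qed

lemma abs_set_integral_diff_le:
  fixes f :: "real \<Rightarrow> real"
  assumes "0 \<le> s" "s \<le> t" "set_integrable lebesgue {0..t} f"
    and "\<And>u. u \<in> {0..t} \<Longrightarrow> \<bar>f u\<bar> \<le> c"
  shows "\<bar>(LINT u:{0..t}|lebesgue. f u) - (LINT u:{0..s}|lebesgue. f u)\<bar> \<le> c * (t - s)"
proof -
  have int: "set_integrable lebesgue {0..s} f" "set_integrable lebesgue {s<..t} f"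
    using assms(1,2) by (auto intro!: set_integrable_subset[OF assms(3)])
  \<comment> \<open>The second interval is open at \<open>s\<close>, which makes the union disjoint
    and the integral additive.\<close>
  have split: "{0..t} = {0..s} \<union> {s<..t}" using assms(1,2) by auto
  have "(LINT u:{0..t}|lebesgue. f u) - (LINT u:{0..s}|lebesgue. f u) = (LINT u:{s<..t}|lebesgue. f u)"
    unfolding split by (subst set_integral_Un) (auto simp: int)
  also have "\<bar>\<dots>\<bar> \<le> (LINT u:{s<..t}|lebesgue. \<bar>f u\<bar>)"
    using set_integral_norm_bound[OF int(2)] by simp
  also have "\<dots> \<le> (LINT u:{s<..t}|lebesgue. c)"
    using assms int(2)
    by (intro set_integral_mono set_integrable_abs) (auto simp: set_integrable_def)
  also have "\<dots> = c * (t - s)"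
    using assms(2) by (simp add: set_lebesgue_integral_def)
  finally show ?thesis .
qed

text \<open>The deterministic core, for one fixed path: a small \<open>y\<close> and a bounded drift
  \<open>a\<close> force the increments of \<open>x\<close> to be small. Probability enters only
  afterwards.\<close>

lemma increment_lp_le_of_path_sup_norm_le:
  assumes "0 < p" "0 < \<epsilon>" and adm: "(N, \<delta>, I) \<in> admissible T p \<epsilon>"
    and int: "\<And>t. t \<in> {0..T} \<Longrightarrow> set_integrable lebesgue {0..t} a"
    and y: "\<And>t. t \<in> {0..T} \<Longrightarrow> y t = x t + (LINT s:{0..t}|lebesgue. a s)"
    and y_le: "path_sup_norm T y \<le> ennreal \<epsilon>"
    and a_le: "path_sup_norm T a \<le> ennreal (I / 4 * real N powr (- (1 / p)) / \<delta>)"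
  shows "increment_lp p N \<delta> x \<le> 3 / 4 * I"
proof -
  \<comment> \<open>This \<open>c\<close> bounds the drift itself; the quantity called c in the
    overview is \<open>c * \<delta>\<close>, the bound on the integral of \<open>a\<close> over one
    grid step.\<close>
  define c where "c = I / 4 * real N powr (- (1 / p)) / \<delta>"
  from adm have N: "1 \<le> N" and \<delta>: "0 < \<delta>" and I: "0 < I"
    and le: "4 * real N powr (1 / p) \<le> I / \<epsilon>" and T: "real N * \<delta> \<le> T"
    by (auto simp: admissible_def)
  have c: "0 \<le> c" using \<delta> I by (simp add: c_def)
  have pos: "0 < real N powr (1 / p)" using N by simp
  have "\<bar>x (real k * \<delta>) - x (real (k - 1) * \<delta>)\<bar> \<le> 2 * \<epsilon> + c * \<delta>" if k: "k \<in> {1..N}" for k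
  proof -
    let ?t = "real k * \<delta>" and ?s = "real (k - 1) * \<delta>"
    have "?t \<le> real N * \<delta>" using k \<delta> by (intro mult_right_mono) auto
    then have "?t \<le> T" using T by linarith
    \<comment> \<open>Since \<open>1 \<le> k\<close>, the natural number subtraction is not
      truncated.\<close>
    moreover have diff: "?t - ?s = \<delta>" using k by (simp add: of_nat_diff algebra_simps)
    moreover have "0 \<le> ?s" using \<delta> by simp
    ultimately have t: "?t \<in> {0..T}" and s: "?s \<in> {0..T}" and st: "0 \<le> ?s" "?s \<le> ?t"
      using \<delta> unfolding atLeastAtMost_iff by linarith+
    have "\<bar>(LINT u:{0..?t}|lebesgue. a u) - (LINT u:{0..?s}|lebesgue. a u)\<bar> \<le> c * (?t - ?s)"
      using t abs_le_of_path_sup_norm_le[OF a_le[folded c_def] c]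
      by (intro abs_set_integral_diff_le int st) auto
    moreover have "\<bar>y ?t\<bar> \<le> \<epsilon>" "\<bar>y ?s\<bar> \<le> \<epsilon>"
      using \<open>0 < \<epsilon>\<close> s t by (auto intro!: abs_le_of_path_sup_norm_le[OF y_le])
    ultimately show ?thesis using y[OF s] y[OF t] unfolding diff by linarith
  qed
  then have "increment_lp p N \<delta> x \<le> real N powr (1 / p) * (2 * \<epsilon> + c * \<delta>)"
    using assms(1,2) c \<delta> by (intro increment_lp_le) auto
  also have "\<dots> = 2 * \<epsilon> * real N powr (1 / p) + I / 4"
    using \<delta> pos by (simp add: c_def powr_minus field_simps)
  \<comment> \<open>Admissibility multiplied by \<open>\<epsilon> / 2\<close> bounds the first
    summand by \<open>I / 2\<close>.\<close>
  also have "\<dots> \<le> 3 / 4 * I"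
    using le \<open>0 < \<epsilon>\<close> by (simp add: field_simps)
  finally show ?thesis .
qed

theorem theorem2p1:
  fixes M :: "'w measure"
    and X a y :: "real \<Rightarrow> 'w \<Rightarrow> real"
    and T \<epsilon> :: real
  assumes "prob_space M" and "complete_measure M"
    and "0 < T"
    and X_process: "\<And>t. t \<in> {0..T} \<Longrightarrow> X t \<in> borel_measurable M"
    and a_process: "\<And>t. t \<in> {0..T} \<Longrightarrow> a t \<in> borel_measurable M"
    and X_zero: "AE \<omega> in M. X 0 \<omega> = 0"
    and a_integrable: "AE \<omega> in M. \<forall>t\<in>{0..T}. set_integrable lebesgue {0..t} (\<lambda>s. a s \<omega>)"
    and y_eq: "AE \<omega> in M. \<forall>t\<in>{0..T}. y t \<omega> = X t \<omega> + (LINT s:{0..t}|lebesgue. a s \<omega>)"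
    and y_norm: "(\<lambda>\<omega>. path_sup_norm T (\<lambda>t. y t \<omega>)) \<in> borel_measurable M"
    and a_norm: "(\<lambda>\<omega>. path_sup_norm T (\<lambda>t. a t \<omega>)) \<in> borel_measurable M"
    and "0 < \<epsilon>"
  shows "\<P>(\<omega> in M. path_sup_norm T (\<lambda>t. y t \<omega>) \<le> ennreal \<epsilon>)
    \<le> (INF p\<in>{0<..}. INF (N, \<delta>, I)\<in>admissible T p \<epsilon>.
          \<P>(\<omega> in M. \<bar>increment_lp p N \<delta> (\<lambda>t. X t \<omega>) - I\<bar> \<ge> I / 2\<^sup>2)
        + \<P>(\<omega> in M. path_sup_norm T (\<lambda>t. a t \<omega>)
                  \<ge> ennreal (I / 2\<^sup>2 * real N powr (- (1 / p)) / \<delta>)))"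
proof -
  interpret prob_space M by fact
  have bound: "\<P>(\<omega> in M. path_sup_norm T (\<lambda>t. y t \<omega>) \<le> ennreal \<epsilon>)
      \<le> \<P>(\<omega> in M. \<bar>increment_lp p N \<delta> (\<lambda>t. X t \<omega>) - I\<bar> \<ge> I / 2\<^sup>2)
        + \<P>(\<omega> in M. path_sup_norm T (\<lambda>t. a t \<omega>) \<ge> ennreal (I / 2\<^sup>2 * real N powr (- (1 / p)) / \<delta>))"
    (is "measure M ?A \<le> measure M ?B + measure M ?C")
    if p: "0 < p" and adm: "(N, \<delta>, I) \<in> admissible T p \<epsilon>" for p N \<delta> I
  proof -
    from adm have "0 \<le> \<delta>" "real N * \<delta> \<le> T" by (auto simp: admissible_def)
    then have [measurable]: "(\<lambda>\<omega>. increment_lp p N \<delta> (\<lambda>t. X t \<omega>)) \<in> borel_measurable M"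
      using X_process by (rule increment_lp_measurable)
    note y_norm[measurable] a_norm[measurable]
    have B: "?B \<in> sets M" and C: "?C \<in> sets M" by measurable
    \<comment> \<open>The inclusion of events is claimed only almost everywhere, since integrability
      of \<open>a\<close> and the equation for \<open>y\<close> are assumed only almost
      surely.\<close>
    have "AE \<omega> in M. \<omega> \<in> ?A \<longrightarrow> \<omega> \<in> ?B \<union> ?C"
      using a_integrable y_eq
    proof eventually_elim
      case (elim \<omega>)
      show ?case
      proof (intro impI, rule ccontr)
        assume A: "\<omega> \<in> ?A" and not: "\<omega> \<notin> ?B \<union> ?C"
        have "increment_lp p N \<delta> (\<lambda>t. X t \<omega>) \<le> 3 / 4 * I"
          using A not elim
          by (intro increment_lp_le_of_path_sup_norm_le[OF p \<open>0 < \<epsilon>\<close> adm,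
                where a = "\<lambda>t. a t \<omega>" and y = "\<lambda>t. y t \<omega>"]) auto
        \<comment> \<open>Being outside \<open>?B\<close> puts the increment norm strictly above
          \<open>3 / 4 * I\<close>, against the pathwise bound.\<close>
        moreover have "\<bar>increment_lp p N \<delta> (\<lambda>t. X t \<omega>) - I\<bar> < I / 4"
          using A not by auto
        ultimately show False by linarith
      qed
    qed
    then have "measure M ?A \<le> measure M (?B \<union> ?C)"
      using B C by (intro finite_measure_mono_AE) auto
    also have "\<dots> \<le> measure M ?B + measure M ?C"
      using B C by (rule measure_Un_le)
    finally show ?thesis .
  qed
  show ?thesis
  \<comment> \<open>A lower bound for every member passes to a real infimum only over a nonempty
    index set; this is checked for both infima, the outer one by the closing
    \<open>simp\<close>.\<close>
  proof (intro cINF_greatest admissible_nonempty \<open>0 < T\<close> \<open>0 < \<epsilon>\<close>)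
    fix p :: real and z
    assume "p \<in> {0<..}" "z \<in> admissible T p \<epsilon>"
    then show "\<P>(\<omega> in M. path_sup_norm T (\<lambda>t. y t \<omega>) \<le> ennreal \<epsilon>)
      \<le> (case z of (N, \<delta>, I) \<Rightarrow>
          \<P>(\<omega> in M. \<bar>increment_lp p N \<delta> (\<lambda>t. X t \<omega>) - I\<bar> \<ge> I / 2\<^sup>2)
        + \<P>(\<omega> in M. path_sup_norm T (\<lambda>t. a t \<omega>) \<ge> ennreal (I / 2\<^sup>2 * real N powr (- (1 / p)) / \<delta>)))"
      using bound by (cases z) (simp only: greaterThan_iff prod.case)
  qed simp
qed

end
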